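(* Let $M^{2n+1}(f,Q,\xi,\eta,g)$ be a weak quasi-contact metric manifold such that $\nabla_X\,\xi=-fX$ for all $X\in\mathfrak{X}_M$. Then $Q={\rm id}$, and $M(f,\xi,\eta,g)$ is a K-contact manifold.
   Context: $\mathfrak{X}_M$ denotes the Lie algebra of smooth vector fields on a smooth manifold $M$ of dimension $2n+1$, and $\nabla$ is the Levi-Civita connection of $g$. A weak almost-contact metric structure $(f,Q,\xi,\eta,g)$ on $M^{2n+1}$ consists of a $(1,1)$-tensor $f$, a nonsingular $(1,1)$-tensor $Q$, a vector field $\xi$, a 1-form $\eta$ and a Riemannian metric $g$ such that $f^2=-Q+\eta\otimes\xi$, $\eta(\xi)=1$, $g(fX,fY)=g(X,QY)-\eta(X)\eta(Y)$, $\eta(X)=g(\xi,X)$ for all $X,Y\in\mathfrak{X}_M$. (Then $f\xi=0$, $\eta\circ f=0$, $\eta\circ Q=\eta$, $Q\xi=\xi$, $Qf=fQ$, $f$ is skew-symmetric, $Q$ is self-adjoint and positive definite, and ${\rm rank}\,f=2n$.) When $Q={\rm id}$, the structure $(f,\xi,\eta,g)$ is called an almost-contact metric structure. The $(1,1)$-tensor $h$ is $h=\frac12\,\mathcal{L}_\xi f$, where $(\mathcal{L}_Z f)X=[Z,fX]-f[Z,X]$. A weak quasi-contact metric manifold is one with a weak almost-contact metric structure satisfying, for all $X,Y\in\mathfrak{X}_M$, $$(\nabla_X f)Y+(\nabla_{fX}f)fY=2\,g(X,Y)\,\xi-\eta(Y)\big(X+hX+\eta(X)\,\xi\big).$$ A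 contact metric manifold is an almost-contact metric manifold with $d\eta=\Phi$, where $\Phi(X,Y)=g(X,fY)$ and $2\,d\eta(X,Y)=X(\eta(Y))-Y(\eta(X))-\eta([X,Y])$. A K-contact manifold is a contact metric manifold for which $\xi$ is a Killing vector field. *)

theory Defs
  imports "HOL-Analysis.Analysis" "HOL-Library.Function_Algebras"
begin

section \<open>Smooth manifolds\<close>

text \<open>On an open set of a finite-dimensional space this is the usual class \<open>C\<^sup>k\<close>:
  \<open>F\<close> is differentiable and all its directional derivatives are of class \<open>C\<^sup>k\<^sup>-\<^sup>1\<close>.\<close>

fun Ck_on :: "nat \<Rightarrow> 'a::real_normed_vector set \<Rightarrow> ('a \<Rightarrow> 'b::real_normed_vector) \<Rightarrow> bool" where
  "Ck_on 0 S F \<longleftrightarrow> continuous_on S F"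
| "Ck_on (Suc k) S F \<longleftrightarrow>
     (\<forall>x\<in>S. F differentiable (at x)) \<and>
     (\<forall>v. Ck_on k S (\<lambda>x. frechet_derivative F (at x) v))"

definition smooth_on :: "'a::real_normed_vector set \<Rightarrow> ('a \<Rightarrow> 'b::real_normed_vector) \<Rightarrow> bool" where
  "smooth_on S F \<longleftrightarrow> (\<forall>k. Ck_on k S F)"

text \<open>A chart is a pair of a domain \<open>U\<close> and a coordinate map, of which only the values on \<open>U\<close>
  matter. The underlying set of the manifold is the whole type \<open>'m\<close>.\<close>

type_synonym ('m, 'e) chart = "'m set \<times> ('m \<Rightarrow> 'e)"

definition smooth_manifold ::
    "('m::{t2_space, second_countable_topology}, 'e::euclidean_space) chart set \<Rightarrow> bool" where
  "smooth_manifold A \<longleftrightarrow>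
     (\<Union>(U, \<kappa>)\<in>A. U) = UNIV \<and>
     (\<forall>(U, \<kappa>)\<in>A. open U \<and> open (\<kappa> ` U) \<and> homeomorphism U (\<kappa> ` U) \<kappa> (inv_into U \<kappa>)) \<and>
     (\<forall>(U, \<kappa>)\<in>A. \<forall>(V, \<mu>)\<in>A. smooth_on (\<kappa> ` (U \<inter> V)) (\<mu> \<circ> inv_into U \<kappa>))"

definition smooth_funs ::
    "('m::{t2_space, second_countable_topology}, 'e::euclidean_space) chart set \<Rightarrow> ('m \<Rightarrow> real) set" where
  "smooth_funs A = {\<phi>. \<forall>(U, \<kappa>)\<in>A. smooth_on (\<kappa> ` U) (\<phi> \<circ> inv_into U \<kappa>)}"

section \<open>Tangent vectors and vector fields\<close>

text \<open>Tangent vectors at \<open>p\<close> are the derivations at \<open>p\<close> of the algebra of smooth functions. They are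
  set to \<open>0\<close> on non-smooth arguments, so that they are equal as soon as they agree on smooth
  functions. Sums, products and negatives of functions are pointwise.\<close>

definition tangent_space ::
    "('m::{t2_space, second_countable_topology}, 'e::euclidean_space) chart set \<Rightarrow> 'm
      \<Rightarrow> (('m \<Rightarrow> real) \<Rightarrow> real) set" where
  "tangent_space A p = {v.
     (\<forall>\<phi>\<in>smooth_funs A. \<forall>\<psi>\<in>smooth_funs A. v (\<phi> + \<psi>) = v \<phi> + v \<psi>) \<and>
     (\<forall>c. \<forall>\<phi>\<in>smooth_funs A. v (\<lambda>q. c * \<phi> q) = c * v \<phi>) \<and>
     (\<forall>\<phi>\<in>smooth_funs A. \<forall>\<psi>\<in>smooth_funs A. v (\<phi> * \<psi>) = \<phi> p * v \<psi> + \<psi> p * v \<phi>) \<and>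
     (\<forall>\<phi>. \<phi> \<notin> smooth_funs A \<longrightarrow> v \<phi> = 0)}"

type_synonym 'm vfield = "'m \<Rightarrow> ('m \<Rightarrow> real) \<Rightarrow> real"

definition vf_apply :: "'m vfield \<Rightarrow> ('m \<Rightarrow> real) \<Rightarrow> 'm \<Rightarrow> real" where
  "vf_apply X \<phi> = (\<lambda>p. X p \<phi>)"

definition vfields ::
    "('m::{t2_space, second_countable_topology}, 'e::euclidean_space) chart set \<Rightarrow> 'm vfield set" where
  "vfields A = {X. (\<forall>p. X p \<in> tangent_space A p) \<and>
                   (\<forall>\<phi>\<in>smooth_funs A. vf_apply X \<phi> \<in> smooth_funs A)}"

definition fscale :: "('m \<Rightarrow> real) \<Rightarrow> 'm vfield \<Rightarrow> 'm vfield" (infixr "\<odot>" 75) where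
  "\<phi> \<odot> X = (\<lambda>p \<psi>. \<phi> p * X p \<psi>)"

definition lie_bracket :: "'m vfield \<Rightarrow> 'm vfield \<Rightarrow> 'm vfield" where
  "lie_bracket X Y = (\<lambda>p \<phi>. X p (vf_apply Y \<phi>) - Y p (vf_apply X \<phi>))"

section \<open>Tensor fields, as multilinear maps over the smooth functions\<close>

definition tensor11 ::
    "('m::{t2_space, second_countable_topology}, 'e::euclidean_space) chart set
      \<Rightarrow> ('m vfield \<Rightarrow> 'm vfield) \<Rightarrow> bool" where
  "tensor11 A T \<longleftrightarrow>
     (\<forall>X\<in>vfields A. T X \<in> vfields A) \<and>
     (\<forall>X\<in>vfields A. \<forall>Y\<in>vfields A. T (X + Y) = T X + T Y) \<and>
     (\<forall>\<phi>\<in>smooth_funs A. \<forall>X\<in>vfields A. T (\<phi> \<odot> X) = \<phi> \<odot> T X)"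

text \<open>The value of \<open>T X\<close> at \<open>p\<close> depends only on \<open>X p\<close>, and every tangent vector at \<open>p\<close> is such a
  value, so this says that each endomorphism \<open>T\<^sub>p\<close> of the tangent space at \<open>p\<close> has trivial kernel.\<close>

definition nonsingular11 ::
    "('m::{t2_space, second_countable_topology}, 'e::euclidean_space) chart set
      \<Rightarrow> ('m vfield \<Rightarrow> 'm vfield) \<Rightarrow> bool" where
  "nonsingular11 A T \<longleftrightarrow> tensor11 A T \<and> (\<forall>X\<in>vfields A. \<forall>p. T X p = 0 \<longrightarrow> X p = 0)"

definition one_form ::
    "('m::{t2_space, second_countable_topology}, 'e::euclidean_space) chart set
      \<Rightarrow> ('m vfield \<Rightarrow> 'm \<Rightarrow> real) \<Rightarrow> bool" where
  "one_form A \<eta> \<longleftrightarrow>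
     (\<forall>X\<in>vfields A. \<eta> X \<in> smooth_funs A) \<and>
     (\<forall>X\<in>vfields A. \<forall>Y\<in>vfields A. \<eta> (X + Y) = \<eta> X + \<eta> Y) \<and>
     (\<forall>\<phi>\<in>smooth_funs A. \<forall>X\<in>vfields A. \<eta> (\<phi> \<odot> X) = \<phi> * \<eta> X)"

definition riemannian_metric ::
    "('m::{t2_space, second_countable_topology}, 'e::euclidean_space) chart set
      \<Rightarrow> ('m vfield \<Rightarrow> 'm vfield \<Rightarrow> 'm \<Rightarrow> real) \<Rightarrow> bool" where
  "riemannian_metric A g \<longleftrightarrow>
     (\<forall>X\<in>vfields A. one_form A (g X)) \<and>
     (\<forall>X\<in>vfields A. \<forall>Y\<in>vfields A. g X Y = g Y X) \<and>
     (\<forall>X\<in>vfields A. \<forall>p. X p \<noteq> 0 \<longrightarrow> g X X p > 0)"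

section \<open>Levi-Civita connection and derived operators\<close>

definition affine_connection ::
    "('m::{t2_space, second_countable_topology}, 'e::euclidean_space) chart set
      \<Rightarrow> ('m vfield \<Rightarrow> 'm vfield \<Rightarrow> 'm vfield) \<Rightarrow> bool" where
  "affine_connection A nab \<longleftrightarrow>
     (\<forall>Y\<in>vfields A. tensor11 A (\<lambda>X. nab X Y)) \<and>
     (\<forall>X\<in>vfields A. \<forall>Y\<in>vfields A. \<forall>Z\<in>vfields A. nab X (Y + Z) = nab X Y + nab X Z) \<and>
     (\<forall>\<phi>\<in>smooth_funs A. \<forall>X\<in>vfields A. \<forall>Y\<in>vfields A.
        nab X (\<phi> \<odot> Y) = vf_apply X \<phi> \<odot> Y + \<phi> \<odot> nab X Y)"

definition levi_civita ::
    "('m::{t2_space, second_countable_topology}, 'e::euclidean_space) chart set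
      \<Rightarrow> ('m vfield \<Rightarrow> 'm vfield \<Rightarrow> 'm \<Rightarrow> real)
      \<Rightarrow> ('m vfield \<Rightarrow> 'm vfield \<Rightarrow> 'm vfield) \<Rightarrow> bool" where
  "levi_civita A g nab \<longleftrightarrow>
     affine_connection A nab \<and>
     (\<forall>X\<in>vfields A. \<forall>Y\<in>vfields A. nab X Y - nab Y X = lie_bracket X Y) \<and>
     (\<forall>X\<in>vfields A. \<forall>Y\<in>vfields A. \<forall>Z\<in>vfields A.
        vf_apply X (g Y Z) = g (nab X Y) Z + g Y (nab X Z))"

definition cov_deriv11 ::
    "('m vfield \<Rightarrow> 'm vfield \<Rightarrow> 'm vfield) \<Rightarrow> ('m vfield \<Rightarrow> 'm vfield)
      \<Rightarrow> 'm vfield \<Rightarrow> 'm vfield \<Rightarrow> 'm vfield" where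
  "cov_deriv11 nab T X Y = nab X (T Y) - T (nab X Y)"

definition lie_deriv11 ::
    "'m vfield \<Rightarrow> ('m vfield \<Rightarrow> 'm vfield) \<Rightarrow> 'm vfield \<Rightarrow> 'm vfield" where
  "lie_deriv11 Z T X = lie_bracket Z (T X) - T (lie_bracket Z X)"

text \<open>The factor \<open>1/2\<close> is part of the convention for the exterior derivative used here.\<close>

definition ext_deriv1 :: "('m vfield \<Rightarrow> 'm \<Rightarrow> real) \<Rightarrow> 'm vfield \<Rightarrow> 'm vfield \<Rightarrow> 'm \<Rightarrow> real" where
  "ext_deriv1 \<eta> X Y =
     (\<lambda>p. (vf_apply X (\<eta> Y) p - vf_apply Y (\<eta> X) p - \<eta> (lie_bracket X Y) p) / 2)"

definition lie_deriv_metric ::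
    "'m vfield \<Rightarrow> ('m vfield \<Rightarrow> 'm vfield \<Rightarrow> 'm \<Rightarrow> real)
      \<Rightarrow> 'm vfield \<Rightarrow> 'm vfield \<Rightarrow> 'm \<Rightarrow> real" where
  "lie_deriv_metric Z g X Y =
     vf_apply Z (g X Y) - g (lie_bracket Z X) Y - g X (lie_bracket Z Y)"

definition killing ::
    "('m::{t2_space, second_countable_topology}, 'e::euclidean_space) chart set
      \<Rightarrow> ('m vfield \<Rightarrow> 'm vfield \<Rightarrow> 'm \<Rightarrow> real) \<Rightarrow> 'm vfield \<Rightarrow> bool" where
  "killing A g Z \<longleftrightarrow> Z \<in> vfields A \<and>
     (\<forall>X\<in>vfields A. \<forall>Y\<in>vfields A. lie_deriv_metric Z g X Y = 0)"

section \<open>Weak almost-contact metric structures\<close>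

definition weak_almost_contact_metric ::
    "('m::{t2_space, second_countable_topology}, 'e::euclidean_space) chart set
      \<Rightarrow> ('m vfield \<Rightarrow> 'm vfield) \<Rightarrow> ('m vfield \<Rightarrow> 'm vfield) \<Rightarrow> 'm vfield
      \<Rightarrow> ('m vfield \<Rightarrow> 'm \<Rightarrow> real) \<Rightarrow> ('m vfield \<Rightarrow> 'm vfield \<Rightarrow> 'm \<Rightarrow> real) \<Rightarrow> bool" where
  "weak_almost_contact_metric A f Q \<xi> \<eta> g \<longleftrightarrow>
     tensor11 A f \<and> nonsingular11 A Q \<and> \<xi> \<in> vfields A \<and> one_form A \<eta> \<and> riemannian_metric A g \<and>
     (\<forall>X\<in>vfields A. f (f X) = - Q X + \<eta> X \<odot> \<xi>) \<and>
     \<eta> \<xi> = 1 \<and>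
     (\<forall>X\<in>vfields A. \<forall>Y\<in>vfields A. g (f X) (f Y) = g X (Q Y) - \<eta> X * \<eta> Y) \<and>
     (\<forall>X\<in>vfields A. \<eta> X = g \<xi> X)"

definition almost_contact_metric ::
    "('m::{t2_space, second_countable_topology}, 'e::euclidean_space) chart set
      \<Rightarrow> ('m vfield \<Rightarrow> 'm vfield) \<Rightarrow> 'm vfield
      \<Rightarrow> ('m vfield \<Rightarrow> 'm \<Rightarrow> real) \<Rightarrow> ('m vfield \<Rightarrow> 'm vfield \<Rightarrow> 'm \<Rightarrow> real) \<Rightarrow> bool" where
  "almost_contact_metric A f \<xi> \<eta> g \<longleftrightarrow> weak_almost_contact_metric A f id \<xi> \<eta> g"

definition tensor_h :: "('m vfield \<Rightarrow> 'm vfield) \<Rightarrow> 'm vfield \<Rightarrow> 'm vfield \<Rightarrow> 'm vfield" where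
  "tensor_h f \<xi> X = (\<lambda>p. 1 / 2) \<odot> lie_deriv11 \<xi> f X"

definition weak_quasi_contact_metric ::
    "('m::{t2_space, second_countable_topology}, 'e::euclidean_space) chart set
      \<Rightarrow> ('m vfield \<Rightarrow> 'm vfield) \<Rightarrow> ('m vfield \<Rightarrow> 'm vfield) \<Rightarrow> 'm vfield
      \<Rightarrow> ('m vfield \<Rightarrow> 'm \<Rightarrow> real) \<Rightarrow> ('m vfield \<Rightarrow> 'm vfield \<Rightarrow> 'm \<Rightarrow> real)
      \<Rightarrow> ('m vfield \<Rightarrow> 'm vfield \<Rightarrow> 'm vfield) \<Rightarrow> bool" where
  "weak_quasi_contact_metric A f Q \<xi> \<eta> g nab \<longleftrightarrow>
     weak_almost_contact_metric A f Q \<xi> \<eta> g \<and> levi_civita A g nab \<and>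
     (\<forall>X\<in>vfields A. \<forall>Y\<in>vfields A.
        cov_deriv11 nab f X Y + cov_deriv11 nab f (f X) (f Y)
        = (2 * g X Y) \<odot> \<xi> - \<eta> Y \<odot> (X + tensor_h f \<xi> X + \<eta> X \<odot> \<xi>))"

definition contact_metric ::
    "('m::{t2_space, second_countable_topology}, 'e::euclidean_space) chart set
      \<Rightarrow> ('m vfield \<Rightarrow> 'm vfield) \<Rightarrow> 'm vfield
      \<Rightarrow> ('m vfield \<Rightarrow> 'm \<Rightarrow> real) \<Rightarrow> ('m vfield \<Rightarrow> 'm vfield \<Rightarrow> 'm \<Rightarrow> real) \<Rightarrow> bool" where
  "contact_metric A f \<xi> \<eta> g \<longleftrightarrow> almost_contact_metric A f \<xi> \<eta> g \<and>
     (\<forall>X\<in>vfields A. \<forall>Y\<in>vfields A. ext_deriv1 \<eta> X Y = g X (f Y))"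

definition K_contact ::
    "('m::{t2_space, second_countable_topology}, 'e::euclidean_space) chart set
      \<Rightarrow> ('m vfield \<Rightarrow> 'm vfield) \<Rightarrow> 'm vfield
      \<Rightarrow> ('m vfield \<Rightarrow> 'm \<Rightarrow> real) \<Rightarrow> ('m vfield \<Rightarrow> 'm vfield \<Rightarrow> 'm \<Rightarrow> real) \<Rightarrow> bool" where
  "K_contact A f \<xi> \<eta> g \<longleftrightarrow> contact_metric A f \<xi> \<eta> g \<and> killing A g \<xi>"

end

theory Submission
  imports Defs
begin

text \<open>
  Since \<open>\<xi>\<close> is a unit field, \<open>\<nabla>\<xi> = -f\<close> forces \<open>\<eta> \<circ> f = 0\<close>. Together with the compatibility of \<open>f\<close>
  and \<open>g\<close> this gives \<open>g (f \<xi>) (f \<xi>) = - \<eta> (f (f \<xi>)) = 0\<close>, so \<open>f \<xi> = 0\<close>. Because \<open>\<nabla>\<close> is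
  torsion-free, \<open>\<L>\<^sub>\<xi> f = \<nabla>\<^sub>\<xi> f\<close>: the two terms in which they differ are both \<open>f\<^sup>2\<close>, with opposite
  signs.

  The weak quasi-contact equation is then evaluated twice, and each time the term with
  \<open>\<nabla>\<^bsub>f X\<^esub> f\<close> drops out because \<open>f \<xi> = 0\<close>. With \<open>\<xi>\<close> in the first slot it says \<open>\<nabla>\<^sub>\<xi> f = 0\<close>, whence
  \<open>h = 0\<close>; with \<open>\<xi>\<close> in the second slot it says \<open>f\<^sup>2 X = \<eta> X \<xi> - X - h X\<close>, which compared with
  \<open>f\<^sup>2 = -Q + \<eta> \<otimes> \<xi>\<close> yields \<open>Q = id\<close> (lemma \<open>Q_eq_id\<close>).

  Once \<open>Q = id\<close>, the compatibility of \<open>f\<close> and \<open>g\<close> makes \<open>f\<close> skew-symmetric. As \<open>f = -\<nabla>\<xi>\<close>, the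
  skewness of \<open>\<nabla>\<xi>\<close> is exactly the Killing equation, and the exterior derivative of the dual form
  \<open>\<eta>\<close> is the form \<open>\<Phi>\<close>. The whole computation is linear algebra over the smooth functions. The only
  analysis in it is that smooth functions, hence vector fields, form a real vector space, and that
  constant functions are smooth.
\<close>

section \<open>Linear structure of smooth functions and vector fields\<close>

lemma Ck_on_cong:
  assumes "open S" "\<And>x. x \<in> S \<Longrightarrow> F x = G x" "Ck_on k S F"
  shows "Ck_on k S G"
  using assms(2,3)
proof (induction k arbitrary: F G)
  case 0
  then show ?case using continuous_on_cong by auto
next
  case (Suc k)
  have der: "(F has_derivative D) (at x) \<longleftrightarrow> (G has_derivative D) (at x)" if "x \<in> S" for x D
    using has_derivative_transform_within_open[of F D x UNIV S G]
      has_derivative_transform_within_open[of G D x UNIV S F] assms(1) that Suc.prems(1) by auto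
  have "frechet_derivative F (at x) = frechet_derivative G (at x)" if "x \<in> S" for x
    unfolding frechet_derivative_def using der[OF that] by simp
  then have "Ck_on k S (\<lambda>x. frechet_derivative G (at x) v)" for v
    using Suc.IH[of "\<lambda>x. frechet_derivative F (at x) v" "\<lambda>x. frechet_derivative G (at x) v"]
      Suc.prems(2) by simp
  moreover have "G differentiable (at x)" if "x \<in> S" for x
  proof -
    obtain D where "(F has_derivative D) (at x)"
      using Suc.prems(2) \<open>x \<in> S\<close> by (auto simp: differentiable_def)
    then show ?thesis
      using der[OF that] by (auto simp: differentiable_def)
  qed
  ultimately show ?case by simp
qed

text \<open>Openness matters: outside \<open>S\<close> the value of \<open>frechet_derivative\<close> is arbitrary, and linear
  only where \<open>F\<close> and \<open>G\<close> are differentiable.\<close>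

lemma Ck_on_linear_combination:
  assumes "open S" "Ck_on k S F" "Ck_on k S G"
  shows "Ck_on k S (\<lambda>x. a *\<^sub>R F x + b *\<^sub>R G x)"
  using assms(2,3)
proof (induction k arbitrary: F G)
  case 0
  then show ?case by (auto intro!: continuous_intros)
next
  case (Suc k)
  let ?H = "\<lambda>x. a *\<^sub>R F x + b *\<^sub>R G x"
  let ?D = "\<lambda>x v. a *\<^sub>R frechet_derivative F (at x) v + b *\<^sub>R frechet_derivative G (at x) v"
  have der: "(?H has_derivative ?D x) (at x)" if "x \<in> S" for x
    using Suc.prems that
    by (auto intro!: has_derivative_add has_derivative_scaleR_right
        simp: frechet_derivative_works[symmetric])
  have eq: "frechet_derivative ?H (at x) = ?D x" if "x \<in> S" for x
    using frechet_derivative_at[OF der[OF that]] by simp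
  have "Ck_on k S (\<lambda>x. frechet_derivative ?H (at x) v)" for v
  proof (rule Ck_on_cong[OF assms(1)])
    show "?D x v = frechet_derivative ?H (at x) v" if "x \<in> S" for x
      using eq[OF that] by simp
    show "Ck_on k S (\<lambda>x. ?D x v)"
      using Suc by simp
  qed
  moreover have "?H differentiable (at x)" if "x \<in> S" for x
    using der[OF that] unfolding differentiable_def by blast
  ultimately show ?case
    by simp
qed

lemma Ck_on_const: "Ck_on k S (\<lambda>x. c)"
  by (induction k arbitrary: c) auto

lemma smooth_funs_const: "(\<lambda>p. c) \<in> smooth_funs A"
  by (auto simp: smooth_funs_def smooth_on_def o_def Ck_on_const)

lemma smooth_funs_linear_combination:
  assumes "smooth_manifold A" "\<phi> \<in> smooth_funs A" "\<psi> \<in> smooth_funs A"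
  shows "(\<lambda>p. a * \<phi> p + b * \<psi> p) \<in> smooth_funs A"
  unfolding smooth_funs_def
proof clarify
  fix U \<kappa> assume U: "(U, \<kappa>) \<in> A"
  have "open (\<kappa> ` U)"
    using assms(1) U unfolding smooth_manifold_def by auto
  moreover have "smooth_on (\<kappa> ` U) (\<phi> \<circ> inv_into U \<kappa>)" "smooth_on (\<kappa> ` U) (\<psi> \<circ> inv_into U \<kappa>)"
    using assms(2,3) U unfolding smooth_funs_def by auto
  ultimately show "smooth_on (\<kappa> ` U) ((\<lambda>p. a * \<phi> p + b * \<psi> p) \<circ> inv_into U \<kappa>)"
    using Ck_on_linear_combination[of "\<kappa> ` U" _ "\<phi> \<circ> inv_into U \<kappa>" "\<psi> \<circ> inv_into U \<kappa>" a b]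
    by (auto simp: smooth_on_def o_def)
qed

lemma vfields_linear_combination:
  assumes "smooth_manifold A" "X \<in> vfields A" "Y \<in> vfields A"
  shows "(\<lambda>p \<phi>. a * X p \<phi> + b * Y p \<phi>) \<in> vfields A"
proof -
  have "(\<lambda>\<phi>. a * X p \<phi> + b * Y p \<phi>) \<in> tangent_space A p" for p
  proof -
    have "X p \<in> tangent_space A p" "Y p \<in> tangent_space A p"
      using assms by (auto simp: vfields_def)
    then show ?thesis
      unfolding tangent_space_def by (auto simp: algebra_simps)
  qed
  moreover have "(\<lambda>p. a * X p \<phi> + b * Y p \<phi>) \<in> smooth_funs A" if "\<phi> \<in> smooth_funs A" for \<phi>
    using smooth_funs_linear_combination[of A "vf_apply X \<phi>" "vf_apply Y \<phi>" a b] assms that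
    by (auto simp: vfields_def vf_apply_def)
  ultimately show ?thesis
    by (simp add: vfields_def vf_apply_def)
qed

lemma vfields_add:
  "smooth_manifold A \<Longrightarrow> X \<in> vfields A \<Longrightarrow> Y \<in> vfields A \<Longrightarrow> X + Y \<in> vfields A"
  using vfields_linear_combination[of A X Y 1 1] by (simp add: plus_fun_def)

lemma vfields_uminus:
  "smooth_manifold A \<Longrightarrow> X \<in> vfields A \<Longrightarrow> - X \<in> vfields A"
  using vfields_linear_combination[of A X X "-1" 0] by (simp add: fun_Compl_def)

lemma vf_apply_one:
  assumes "X \<in> vfields A"
  shows "vf_apply X 1 = 0"
proof
  fix p
  have one: "(1 :: 'a \<Rightarrow> real) \<in> smooth_funs A"
    using smooth_funs_const[of 1 A] by (simp add: one_fun_def)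
  moreover have "X p \<in> tangent_space A p"
    using assms by (simp add: vfields_def)
  ultimately have "X p (1 * 1) = 1 p * X p 1 + 1 p * X p 1"
    unfolding tangent_space_def by blast
  then show "vf_apply X 1 p = 0 p"
    by (simp add: vf_apply_def)
qed

lemma uminus_fscale: "- X = (\<lambda>p. -1) \<odot> X"
  by (simp add: fscale_def fun_eq_iff)

lemma tensor11_uminus:
  "tensor11 A T \<Longrightarrow> X \<in> vfields A \<Longrightarrow> T (- X) = - T X"
  unfolding uminus_fscale using smooth_funs_const[of "-1" A] unfolding tensor11_def by blast

lemma one_form_uminus:
  assumes "one_form A \<omega>" "X \<in> vfields A"
  shows "\<omega> (- X) = - \<omega> X"
  unfolding uminus_fscale[of X] using assms smooth_funs_const[of "-1" A]
  by (auto simp: one_form_def fun_eq_iff)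

section \<open>Weak quasi-contact structures with \<open>\<nabla>\<xi> = -f\<close>\<close>

locale weak_quasi_contact_Reeb =
  fixes A :: "('m::{t2_space, second_countable_topology}, 'e::euclidean_space) chart set"
    and f Q :: "'m vfield \<Rightarrow> 'm vfield"
    and \<xi> :: "'m vfield"
    and \<eta> :: "'m vfield \<Rightarrow> 'm \<Rightarrow> real"
    and g :: "'m vfield \<Rightarrow> 'm vfield \<Rightarrow> 'm \<Rightarrow> real"
    and nab :: "'m vfield \<Rightarrow> 'm vfield \<Rightarrow> 'm vfield"
  assumes manifold: "smooth_manifold A"
    and quasi_contact: "weak_quasi_contact_metric A f Q \<xi> \<eta> g nab"
    and nab_Reeb: "X \<in> vfields A \<Longrightarrow> nab X \<xi> = - f X"
begin

lemma weak_structure: "weak_almost_contact_metric A f Q \<xi> \<eta> g"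
  and levi_civita_nab: "levi_civita A g nab"
  and quasi_contact_eq: "X \<in> vfields A \<Longrightarrow> Y \<in> vfields A \<Longrightarrow>
    cov_deriv11 nab f X Y + cov_deriv11 nab f (f X) (f Y)
        = (2 * g X Y) \<odot> \<xi> - \<eta> Y \<odot> (X + tensor_h f \<xi> X + \<eta> X \<odot> \<xi>)"
  using quasi_contact unfolding weak_quasi_contact_metric_def by blast+

lemma tensor_f: "tensor11 A f" and tensor_Q: "tensor11 A Q"
  and Reeb_vfield: "\<xi> \<in> vfields A" and one_form_\<eta>: "one_form A \<eta>"
  and metric: "riemannian_metric A g"
  and f_f: "X \<in> vfields A \<Longrightarrow> f (f X) = - Q X + \<eta> X \<odot> \<xi>"
  and \<eta>_Reeb: "\<eta> \<xi> = 1"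
  and g_f_f: "X \<in> vfields A \<Longrightarrow> Y \<in> vfields A \<Longrightarrow> g (f X) (f Y) = g X (Q Y) - \<eta> X * \<eta> Y"
  and \<eta>_eq: "X \<in> vfields A \<Longrightarrow> \<eta> X = g \<xi> X"
  using weak_structure unfolding weak_almost_contact_metric_def nonsingular11_def by blast+

lemma f_vfield: "X \<in> vfields A \<Longrightarrow> f X \<in> vfields A"
  and f_add: "X \<in> vfields A \<Longrightarrow> Y \<in> vfields A \<Longrightarrow> f (X + Y) = f X + f Y"
  using tensor_f unfolding tensor11_def by blast+

lemma connection: "affine_connection A nab"
  and torsion_free: "X \<in> vfields A \<Longrightarrow> Y \<in> vfields A \<Longrightarrow> lie_bracket X Y = nab X Y - nab Y X"
  and metric_compatible: "X \<in> vfields A \<Longrightarrow> Y \<in> vfields A \<Longrightarrow> Z \<in> vfields A \<Longrightarrow>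
    vf_apply X (g Y Z) = g (nab X Y) Z + g Y (nab X Z)"
  using levi_civita_nab unfolding levi_civita_def by auto

lemma tensor_nab: "Y \<in> vfields A \<Longrightarrow> tensor11 A (\<lambda>X. nab X Y)"
  and nab_add_right: "X \<in> vfields A \<Longrightarrow> Y \<in> vfields A \<Longrightarrow> Z \<in> vfields A \<Longrightarrow>
    nab X (Y + Z) = nab X Y + nab X Z"
  using connection by (simp_all add: affine_connection_def)

lemma nab_vfield: "X \<in> vfields A \<Longrightarrow> Y \<in> vfields A \<Longrightarrow> nab X Y \<in> vfields A"
  using tensor_nab[of Y] by (simp add: tensor11_def)

lemma nab_add_left: "X \<in> vfields A \<Longrightarrow> Y \<in> vfields A \<Longrightarrow> Z \<in> vfields A \<Longrightarrow>
    nab (X + Y) Z = nab X Z + nab Y Z"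
  using tensor_nab[of Z] by (simp add: tensor11_def)

lemma g_form: "X \<in> vfields A \<Longrightarrow> one_form A (g X)"
  and g_sym: "X \<in> vfields A \<Longrightarrow> Y \<in> vfields A \<Longrightarrow> g X Y = g Y X"
  and g_pos: "X \<in> vfields A \<Longrightarrow> X p \<noteq> 0 \<Longrightarrow> g X X p > 0"
  using metric by (simp_all add: riemannian_metric_def)

lemma g_add_right: "X \<in> vfields A \<Longrightarrow> Y \<in> vfields A \<Longrightarrow> Z \<in> vfields A \<Longrightarrow> g X (Y + Z) = g X Y + g X Z"
  using g_form[of X] by (simp add: one_form_def)

lemma g_add_left: "X \<in> vfields A \<Longrightarrow> Y \<in> vfields A \<Longrightarrow> Z \<in> vfields A \<Longrightarrow> g (X + Y) Z = g X Z + g Y Z"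
  using g_add_right[of Z X Y] g_sym[of "X + Y" Z] g_sym[of X Z] g_sym[of Y Z]
    vfields_add[OF manifold, of X Y] by simp

lemma g_uminus_left: "X \<in> vfields A \<Longrightarrow> Y \<in> vfields A \<Longrightarrow> g (- X) Y = - g X Y"
  using one_form_uminus[OF g_form, of Y X] g_sym[of "- X" Y] g_sym[of X Y]
    vfields_uminus[OF manifold, of X] by simp

lemma \<eta>_add: "X \<in> vfields A \<Longrightarrow> Y \<in> vfields A \<Longrightarrow> \<eta> (X + Y) = \<eta> X + \<eta> Y"
  using one_form_\<eta> by (simp add: one_form_def)

text \<open>The Reeb field has constant length, so its covariant derivatives are orthogonal to it.\<close>

lemma \<eta>_f:
  assumes "X \<in> vfields A"
  shows "\<eta> (f X) = 0"
proof -
  have fX: "f X \<in> vfields A" "- f X \<in> vfields A"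
    using assms f_vfield manifold vfields_uminus by auto
  have "vf_apply X (g \<xi> \<xi>) = g (- f X) \<xi> + g \<xi> (- f X)"
    using metric_compatible[OF assms Reeb_vfield Reeb_vfield] nab_Reeb[OF assms] by simp
  also have "\<dots> = - 2 * \<eta> (f X)"
    using g_uminus_left[OF fX(1) Reeb_vfield] g_sym[OF fX(2) Reeb_vfield]
      g_sym[OF fX(1) Reeb_vfield] \<eta>_eq[OF fX(1)] by simp
  also have "vf_apply X (g \<xi> \<xi>) = 0"
    using \<eta>_eq[OF Reeb_vfield] \<eta>_Reeb vf_apply_one[OF assms] by simp
  finally show ?thesis
    by (auto simp: fun_eq_iff)
qed

lemma f_Reeb: "f \<xi> = 0"
proof -
  have "Q \<xi> + f (f \<xi>) = \<xi>"
    using f_f[OF Reeb_vfield] \<eta>_Reeb by (simp add: fscale_def fun_eq_iff)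
  then have "\<eta> (Q \<xi>) + \<eta> (f (f \<xi>)) = 1"
    using \<eta>_add[of "Q \<xi>" "f (f \<xi>)"] tensor_Q Reeb_vfield f_vfield \<eta>_Reeb
    by (simp add: tensor11_def)
  then have "\<eta> (Q \<xi>) = 1"
    using \<eta>_f[OF f_vfield[OF Reeb_vfield]] by simp
  then have "g \<xi> (Q \<xi>) = 1"
    using \<eta>_eq tensor_Q Reeb_vfield by (simp add: tensor11_def)
  then have "g (f \<xi>) (f \<xi>) p = 0" for p
    using g_f_f[OF Reeb_vfield Reeb_vfield] \<eta>_Reeb by simp
  then have "f \<xi> p = 0" for p
    using g_pos[OF f_vfield[OF Reeb_vfield], of p] by fastforce
  then show ?thesis
    by auto
qed

lemma zero_vfield: "0 \<in> vfields A"
  using f_vfield[OF Reeb_vfield] f_Reeb by simp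

lemma f_0: "f 0 = 0"
  using f_add[OF zero_vfield zero_vfield] by simp

lemma nab_0_left: "Y \<in> vfields A \<Longrightarrow> nab 0 Y = 0"
  using nab_add_left[OF zero_vfield zero_vfield] by simp

lemma nab_0_right: "X \<in> vfields A \<Longrightarrow> nab X 0 = 0"
  using nab_add_right[OF _ zero_vfield zero_vfield] by simp

text \<open>This is the derivative of \<open>f \<xi> = 0\<close>, by the product rule.\<close>

lemma cov_deriv_f_Reeb: "X \<in> vfields A \<Longrightarrow> cov_deriv11 nab f X \<xi> = f (f X)"
  by (simp add: cov_deriv11_def f_Reeb nab_0_right nab_Reeb tensor11_uminus[OF tensor_f] f_vfield)

lemma bracket_Reeb: "X \<in> vfields A \<Longrightarrow> lie_bracket \<xi> X = nab \<xi> X + f X"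
  by (simp add: torsion_free Reeb_vfield nab_Reeb)

text \<open>Both \<open>[\<xi>, f X]\<close> and \<open>f [\<xi>, X]\<close> exceed the corresponding covariant derivative by \<open>f (f X)\<close>.\<close>

lemma lie_deriv_eq_cov_deriv:
  assumes "X \<in> vfields A"
  shows "lie_deriv11 \<xi> f X = cov_deriv11 nab f \<xi> X"
  using assms
  by (simp add: lie_deriv11_def cov_deriv11_def bracket_Reeb f_vfield f_add nab_vfield Reeb_vfield)

text \<open>The quasi-contact equation with \<open>\<xi>\<close> in the first slot. Its right-hand side is
  \<open>2 \<eta> Y \<xi> - \<eta> Y (2 \<xi> + h \<xi>)\<close>, and \<open>h \<xi>\<close> is half of \<open>(\<nabla>\<^sub>\<xi> f) \<xi> = f (f \<xi>)\<close>.\<close>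

lemma cov_deriv_along_Reeb:
  assumes "Y \<in> vfields A"
  shows "cov_deriv11 nab f \<xi> Y = 0"
proof -
  have "tensor_h f \<xi> \<xi> = 0"
    by (simp add: tensor_h_def lie_deriv_eq_cov_deriv cov_deriv_f_Reeb Reeb_vfield f_Reeb f_0
        fscale_def fun_eq_iff)
  moreover have "cov_deriv11 nab f (f \<xi>) (f Y) = 0"
    by (simp add: cov_deriv11_def f_Reeb nab_0_left f_vfield assms f_0)
  ultimately have "cov_deriv11 nab f \<xi> Y = (2 * \<eta> Y) \<odot> \<xi> - \<eta> Y \<odot> (\<xi> + 1 \<odot> \<xi>)"
    using quasi_contact_eq[OF Reeb_vfield assms] \<eta>_eq[OF assms] \<eta>_Reeb by simp
  then show ?thesis
    by (simp add: fscale_def fun_eq_iff)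
qed

text \<open>The quasi-contact equation with \<open>\<xi>\<close> in the second slot, where now \<open>h = 0\<close>.\<close>

lemma Q_eq_id:
  assumes "X \<in> vfields A"
  shows "Q X = X"
proof -
  have "tensor_h f \<xi> X = 0"
    by (simp add: tensor_h_def lie_deriv_eq_cov_deriv cov_deriv_along_Reeb assms fscale_def
        fun_eq_iff)
  moreover have "cov_deriv11 nab f (f X) (f \<xi>) = 0"
    by (simp add: cov_deriv11_def f_Reeb nab_0_right f_vfield assms f_0)
  moreover have "g X \<xi> = \<eta> X"
    using g_sym[OF assms Reeb_vfield] \<eta>_eq[OF assms] by simp
  ultimately have "f (f X) = (2 * \<eta> X) \<odot> \<xi> - 1 \<odot> (X + \<eta> X \<odot> \<xi>)"
    using quasi_contact_eq[OF assms Reeb_vfield] cov_deriv_f_Reeb[OF assms] \<eta>_Reeb by simp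
  with f_f[OF assms] show ?thesis
    by (simp add: fscale_def fun_eq_iff)
qed

text \<open>Replacing \<open>Y\<close> by \<open>f Y\<close> in the compatibility of \<open>f\<close> and \<open>g\<close> gives
  \<open>g (f X) (f (f Y)) = g X (f Y)\<close>, while \<open>f (f Y)\<close> differs from \<open>- Y\<close> by a multiple of \<open>\<xi>\<close>, to
  which \<open>f X\<close> is orthogonal.\<close>

lemma f_skew:
  assumes X: "X \<in> vfields A" and Y: "Y \<in> vfields A"
  shows "g (f X) Y = - g X (f Y)"
proof -
  note V = f_vfield[OF X] f_vfield[OF Y] f_vfield[OF f_vfield[OF Y]]
  have "f (f Y) + Y = \<eta> Y \<odot> \<xi>"
    using f_f[OF Y] Q_eq_id[OF Y] by simp
  moreover have "g (f X) (\<eta> Y \<odot> \<xi>) = \<eta> Y * g (f X) \<xi>"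
    using g_form[OF V(1)] one_form_\<eta> Y Reeb_vfield by (simp add: one_form_def)
  moreover have "g (f X) \<xi> = 0"
    using g_sym[OF V(1) Reeb_vfield] \<eta>_eq[OF V(1)] \<eta>_f[OF X] by simp
  ultimately have "g (f X) (f (f Y)) + g (f X) Y = 0"
    using g_add_right[OF V(1) V(3) Y] by simp
  moreover have "g (f X) (f (f Y)) = g X (f Y)"
    using g_f_f[OF X V(2)] Q_eq_id[OF V(2)] \<eta>_f[OF Y] by simp
  ultimately show ?thesis
    by (simp add: eq_neg_iff_add_eq_0 add.commute)
qed

lemma killing_Reeb: "killing A g \<xi>"
proof -
  have "lie_deriv_metric \<xi> g X Y = 0" if X: "X \<in> vfields A" and Y: "Y \<in> vfields A" for X Y
  proof -
    have "g (lie_bracket \<xi> X) Y = g (nab \<xi> X) Y + g (f X) Y"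
      "g X (lie_bracket \<xi> Y) = g X (nab \<xi> Y) + g X (f Y)"
      using X Y by (simp_all add: bracket_Reeb g_add_left g_add_right nab_vfield f_vfield Reeb_vfield)
    then show ?thesis
      using metric_compatible[OF Reeb_vfield X Y] f_skew[OF X Y] by (simp add: lie_deriv_metric_def)
  qed
  then show ?thesis
    by (simp add: killing_def Reeb_vfield)
qed

text \<open>For a torsion-free metric connection, the exterior derivative of the dual form of \<open>\<xi>\<close> is the
  skew part of \<open>\<nabla>\<xi>\<close>, here of \<open>- f\<close>.\<close>

lemma ext_deriv_\<eta>:
  assumes X: "X \<in> vfields A" and Y: "Y \<in> vfields A"
  shows "ext_deriv1 \<eta> X Y = g X (f Y)"
proof -
  have along: "vf_apply U (\<eta> V) = - g (f U) V + \<eta> (nab U V)"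
    if "U \<in> vfields A" "V \<in> vfields A" for U V
    using metric_compatible[OF that(1) Reeb_vfield that(2)] that
    by (simp add: \<eta>_eq nab_Reeb g_uminus_left f_vfield nab_vfield)
  have "\<eta> (lie_bracket X Y) = \<eta> (nab X Y + - nab Y X)"
    using torsion_free[OF X Y] by simp
  also have "\<dots> = \<eta> (nab X Y) - \<eta> (nab Y X)"
    using \<eta>_add[of "nab X Y" "- nab Y X"] one_form_uminus[OF one_form_\<eta>, of "nab Y X"]
      nab_vfield[OF X Y] nab_vfield[OF Y X] vfields_uminus[OF manifold] by simp
  finally have bracket: "\<eta> (lie_bracket X Y) = \<eta> (nab X Y) - \<eta> (nab Y X)" .
  have "g (f Y) X = g X (f Y)"
    by (rule g_sym[OF f_vfield[OF Y] X])
  then show ?thesis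
    by (simp add: ext_deriv1_def along X Y bracket f_skew fun_eq_iff)
qed

lemma almost_contact: "almost_contact_metric A f \<xi> \<eta> g"
proof -
  have "nonsingular11 A id"
    by (simp add: nonsingular11_def tensor11_def)
  then show ?thesis
    unfolding almost_contact_metric_def weak_almost_contact_metric_def
    using tensor_f Reeb_vfield one_form_\<eta> metric f_f \<eta>_Reeb g_f_f \<eta>_eq Q_eq_id by simp
qed

end

theorem theorem1:
  fixes A :: "('m::{t2_space, second_countable_topology}, 'e::euclidean_space) chart set"
    and n :: nat
    and f Q :: "'m vfield \<Rightarrow> 'm vfield"
    and \<xi> :: "'m vfield"
    and \<eta> :: "'m vfield \<Rightarrow> 'm \<Rightarrow> real"
    and g :: "'m vfield \<Rightarrow> 'm vfield \<Rightarrow> 'm \<Rightarrow> real"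
    and nab :: "'m vfield \<Rightarrow> 'm vfield \<Rightarrow> 'm vfield"
  assumes "smooth_manifold A" and "DIM('e) = 2 * n + 1"
    and "weak_quasi_contact_metric A f Q \<xi> \<eta> g nab"
    and "\<forall>X\<in>vfields A. nab X \<xi> = - f X"
  shows "(\<forall>X\<in>vfields A. Q X = X) \<and> K_contact A f \<xi> \<eta> g"
proof -
  interpret weak_quasi_contact_Reeb A f Q \<xi> \<eta> g nab
    using assms by unfold_locales auto
  show ?thesis
    by (simp add: Q_eq_id K_contact_def contact_metric_def almost_contact ext_deriv_\<eta> killing_Reeb)
qed

end
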